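(* Let $R$ be a dependency matrix for a spin system with $n$ sites, and let $\|\cdot\|$ be any matrix norm such that $\|R\|\le\mu<1$. Let $J_n=\|\mathbf J\|$, where $\mathbf J$ is the $n\times n$ all-ones matrix. Then the mixing time $\tau_{\mathrm s}(\varepsilon)$ (number of complete scans) of systematic scan Glauber dynamics is asymptotically bounded by $$\hat\tau_{\mathrm s}(\varepsilon)\sim (1-\mu)^{-1}\ln\big((1-\mu)^{-1}J_n/\varepsilon\big),$$ that is, for fixed $\varepsilon\in(0,1)$ and any sequence of such systems, one for each $n$ (with $R$, $\mu$ and the norm possibly depending on $n$), $$\limsup_{n\to\infty}\frac{\tau_{\mathrm s}(\varepsilon)}{(1-\mu)^{-1}\ln\big((1-\mu)^{-1}J_n/\varepsilon\big)}\le 1 .$$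
   Context: Spin system: the sites are $V=[n]=\{1,\dots,n\}$, the spins are a finite set $\Sigma=[q]$, and $\Omega^+=\Sigma^n$ is the set of configurations; $\pi$ is a probability distribution on $\Omega^+$. For a site $j$, $S_j$ is the set of pairs $(x,y)\in\Omega^+\times\Omega^+$ with $x_i=y_i$ for all $i\ne j$; $x\to^j c$ is the configuration that agrees with $x$ off $j$ and has spin $c$ at $j$. For each site $j$ there is a transition matrix $P^{[j]}$ on $\Omega^+$ such that $P^{[j]}(x,y)>0$ implies $(x,y)\in S_j$, and $\pi P^{[j]}=\pi$. Systematic scan Glauber dynamics is the Markov chain on $\Omega^+$ with transition matrix $P_{\to}=P^{[1]}P^{[2]}\cdots P^{[n]}$ (one transition is one complete scan). Dependency matrix: let $\mu_j(x,c)=P^{[j]}(x,x\to^j c)$, let $d_{\mathrm{TV}}$ be total variation distance, and let $\hat\varrho_{ij}=\max_{(x,y)\in S_i}d_{\mathrm{TV}}(\mu_j(x,\cdot),\mu_j(y,\cdot))$ be the influence of site $i$ on site $j$. A dependency matrix is any $n\times n$ matrix $R=(\varrho_{ij})$ with $\varrho_{ij}\ge\hat\varrho_{ij}$ for all $i,j$. Mixing time: $\tau(\varepsilon)$ is the least $t$ such that $d_{\mathrm{TV}}(x_t,\pi)\le\varepsilon$ for every initial configuration $x_0$, where $x_t$ is the (random) state after $t$ transitions. An asymptotic bound $\hat\tau(\varepsilon)$ is a quantity with $\limsup_{n\to\infty}\tau(\varepsilon)/\hat\tau(\varepsilon)\le1$. Matrix norm: a function $\|\cdot\|:\mathbb R^{m\times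 n}\to\mathbb R_{\ge 0}$ for all $m,n\in\mathbb N$ such that $\|R\|=0$ iff $R=\mathbf 0$; $\|cR\|=|c|\,\|R\|$ for $c\in\mathbb R$; $\|R+S\|\le\|R\|+\|S\|$; and $\|RS\|\le\|R\|\,\|S\|$ whenever the product is defined. *)

theory Defs
  imports "HOL-Probability.Probability_Mass_Function" "Jordan_Normal_Form.Matrix"
begin

text \<open>
  A spin system with \<open>n\<close> sites has sites \<open>{..<n}\<close> and spins \<open>{..<q}\<close>, both numbered from \<open>0\<close> so that
  sites are also the row and column indices of \<open>n \<times> n\<close> matrices. Configurations are extensional
  functions; the configuration that agrees with \<open>x\<close> off \<open>j\<close> and has spin \<open>c\<close> at \<open>j\<close> is \<open>x(j := c)\<close>.
\<close>

definition configs :: "nat \<Rightarrow> nat \<Rightarrow> (nat \<Rightarrow> nat) set" where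
  "configs n q = {..<n} \<rightarrow>\<^sub>E {..<q}"

definition differ_at :: "nat \<Rightarrow> nat \<Rightarrow> nat \<Rightarrow> ((nat \<Rightarrow> nat) \<times> (nat \<Rightarrow> nat)) set" where
  "differ_at n q j =
    {(x, y). x \<in> configs n q \<and> y \<in> configs n q \<and> (\<forall>i<n. i \<noteq> j \<longrightarrow> x i = y i)}"

text \<open>
  A transition matrix is represented by the function sending a state to the distribution of the
  next state, so its \<open>(x, y)\<close> entry is \<open>pmf (K x) y\<close>. Only the rows indexed by configurations matter;
  the support condition below keeps the chain inside the set of configurations. The product of two
  transition matrices is monadic composition, since
  \<open>pmf (bind_pmf (K x) L) y = (\<Sum>z. pmf (K x) z * pmf (L z) y)\<close>.
\<close>

type_synonym 'a kernel = "'a \<Rightarrow> 'a pmf"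

definition kernel_mult :: "'a kernel \<Rightarrow> 'a kernel \<Rightarrow> 'a kernel" where
  "kernel_mult K L = (\<lambda>x. bind_pmf (K x) L)"

definition spin_system ::
  "nat \<Rightarrow> nat \<Rightarrow> (nat \<Rightarrow> nat) pmf \<Rightarrow> (nat \<Rightarrow> (nat \<Rightarrow> nat) kernel) \<Rightarrow> bool" where
  "spin_system n q \<pi> P \<longleftrightarrow>
     set_pmf \<pi> \<subseteq> configs n q \<and>
     (\<forall>j<n. \<forall>x\<in>configs n q. \<forall>y. pmf (P j x) y > 0 \<longrightarrow> (x, y) \<in> differ_at n q j) \<and>
     (\<forall>j<n. bind_pmf \<pi> (P j) = \<pi>)"

definition scan :: "nat \<Rightarrow> (nat \<Rightarrow> 'a kernel) \<Rightarrow> 'a kernel" where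
  "scan n P = foldr kernel_mult (map P [0..<n]) return_pmf"

definition state_after :: "'a kernel \<Rightarrow> nat \<Rightarrow> 'a \<Rightarrow> 'a pmf" where
  "state_after K t x = ((\<lambda>p. bind_pmf p K) ^^ t) (return_pmf x)"

text \<open>Total variation distance of two distributions on a finite set, given by their mass functions.\<close>

definition tv_dist :: "'a set \<Rightarrow> ('a \<Rightarrow> real) \<Rightarrow> ('a \<Rightarrow> real) \<Rightarrow> real" where
  "tv_dist A f g = (\<Sum>a\<in>A. \<bar>f a - g a\<bar>) / 2"

text \<open>The mixing time is \<open>\<infinity>\<close> if no \<open>t\<close> satisfies the condition.\<close>

definition scan_mixing_time ::
  "nat \<Rightarrow> nat \<Rightarrow> (nat \<Rightarrow> nat) pmf \<Rightarrow> (nat \<Rightarrow> (nat \<Rightarrow> nat) kernel) \<Rightarrow> real \<Rightarrow> enat" where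
  "scan_mixing_time n q \<pi> P \<epsilon> =
     (INF t \<in> {t. \<forall>x\<in>configs n q.
        tv_dist (configs n q) (pmf (state_after (scan n P) t x)) (pmf \<pi>) \<le> \<epsilon>}. enat t)"

definition spin_update :: "(nat \<Rightarrow> (nat \<Rightarrow> nat) kernel) \<Rightarrow> nat \<Rightarrow> (nat \<Rightarrow> nat) \<Rightarrow> nat \<Rightarrow> real" where
  "spin_update P j x c = pmf (P j x) (x(j := c))"

definition influence :: "nat \<Rightarrow> nat \<Rightarrow> (nat \<Rightarrow> (nat \<Rightarrow> nat) kernel) \<Rightarrow> nat \<Rightarrow> nat \<Rightarrow> real" where
  "influence n q P i j =
     Max ((\<lambda>(x, y). tv_dist {..<q} (spin_update P j x) (spin_update P j y)) ` differ_at n q i)"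

definition dependency_matrix ::
  "nat \<Rightarrow> nat \<Rightarrow> (nat \<Rightarrow> (nat \<Rightarrow> nat) kernel) \<Rightarrow> real mat \<Rightarrow> bool" where
  "dependency_matrix n q P R \<longleftrightarrow>
     R \<in> carrier_mat n n \<and> (\<forall>i<n. \<forall>j<n. R $$ (i, j) \<ge> influence n q P i j)"

text \<open>
  A matrix norm is a single function on matrices of all dimensions. Empty matrices are included; as
  they are zero matrices, they must have norm \<open>0\<close> and impose no further condition.
\<close>

definition matrix_norm :: "(real mat \<Rightarrow> real) \<Rightarrow> bool" where
  "matrix_norm N \<longleftrightarrow>
     (\<forall>A. N A \<ge> 0) \<and>
     (\<forall>m n. \<forall>A\<in>carrier_mat m n. N A = 0 \<longleftrightarrow> A = 0\<^sub>m m n) \<and>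
     (\<forall>c A. N (c \<cdot>\<^sub>m A) = \<bar>c\<bar> * N A) \<and>
     (\<forall>m n. \<forall>A\<in>carrier_mat m n. \<forall>B\<in>carrier_mat m n. N (A + B) \<le> N A + N B) \<and>
     (\<forall>l m n. \<forall>A\<in>carrier_mat l m. \<forall>B\<in>carrier_mat m n. N (A * B) \<le> N A * N B)"

definition ones_mat :: "nat \<Rightarrow> real mat" where
  "ones_mat n = mat n n (\<lambda>_. 1)"

end

theory Submission
  imports Defs "HOL-Real_Asymp.Real_Asymp"
begin

text \<open>
  The proof tracks a real function \<open>f\<close> on configurations, and a vector \<open>d\<close> of bounds on how much \<open>f\<close>
  changes when a single spin changes. Averaging \<open>f\<close> over an update of site \<open>j\<close> replaces \<open>d i\<close> by
  \<open>d i + R $$ (i, j) * d j\<close> for \<open>i \<noteq> j\<close>, and \<open>d j\<close> by \<open>R $$ (j, j) * d j\<close>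
  (lemma \<open>oscillation_bound_update\<close>). If \<open>w\<close> is a nonnegative row vector with \<open>w R \<le> \<theta> w\<close> and
  \<open>\<theta> \<le> 1\<close>, then one complete scan multiplies the weighted oscillation \<open>\<Sum>i. w i * d i\<close> by at most
  \<open>\<theta>\<close> (lemma \<open>oscillation_bound_scan\<close>). If moreover \<open>w \<ge> 1\<close>, then the total variation distance to
  stationarity after \<open>t\<close> scans is at most \<open>\<theta> ^ t * (\<Sum>i. w i)\<close> (lemma \<open>tv_dist_scan_le\<close>).

  For \<open>\<mu> < \<theta> \<le> 1\<close> such weights come from a long partial sum of the Neumann series
  \<open>\<Sum>k. 1 (R / \<theta>) ^ k\<close>, with \<open>1\<close> the all-ones row vector. The norm need not be monotone in the
  entries of a matrix. It controls the entries as follows: with \<open>J\<close> the all-ones matrix, \<open>J M J\<close> is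
  \<open>J\<close> scaled by the sum of the entries of \<open>M\<close>, so that sum is at most \<open>N J * N M\<close>. Taking the
  powers of \<open>R\<close> for \<open>M\<close> gives
  \<open>(\<Sum>i. w i) \<le> N J / (\<theta> - \<mu>)\<close> (lemma \<open>exists_subinvariant_weights\<close>). The case \<open>M = J\<close> gives
  \<open>N J \<ge> n\<close>, so the logarithm in the claimed bound tends to infinity uniformly in the other
  parameters.

  With \<open>\<theta> = \<mu> + (1 - \<mu>) * \<kappa>\<close> the mixing time is at most
  \<open>ln (N J / ((1 - \<mu>) * \<kappa> * \<epsilon>)) / ((1 - \<mu>) * (1 - \<kappa>))\<close>, rounded up. The choice \<open>\<kappa> = 1 / ln n\<close>
  costs a factor \<open>1 / (1 - \<kappa>)\<close> and an additional \<open>ln (ln n)\<close> next to a logarithm that is at least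
  \<open>ln n\<close>; both are negligible in the limit, and so is the rounding.
\<close>

section \<open>Matrix norms and the sum of the entries\<close>

definition entry_sum :: "real mat \<Rightarrow> real" where
  "entry_sum M = (\<Sum>i<dim_row M. \<Sum>j<dim_col M. M $$ (i, j))"

definition col_sum :: "real mat \<Rightarrow> nat \<Rightarrow> real" where
  "col_sum M j = (\<Sum>i<dim_row M. M $$ (i, j))"

lemma ones_mat_carrier [simp]: "ones_mat n \<in> carrier_mat n n"
  by (simp add: ones_mat_def)

lemma ones_mult_ones:
  assumes "M \<in> carrier_mat n n"
  shows "ones_mat n * M * ones_mat n = entry_sum M \<cdot>\<^sub>m ones_mat n"
proof (rule eq_matI)
  fix i j assume ij: "i < dim_row (entry_sum M \<cdot>\<^sub>m ones_mat n)" "j < dim_col (entry_sum M \<cdot>\<^sub>m ones_mat n)"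
  have "(ones_mat n * M * ones_mat n) $$ (i, j) = (\<Sum>l<n. \<Sum>k<n. M $$ (k, l))"
    using ij assms by (auto simp: ones_mat_def scalar_prod_def atLeast0LessThan intro!: sum.cong)
  also have "\<dots> = entry_sum M"
    using assms by (subst sum.swap) (auto simp: entry_sum_def)
  finally show "(ones_mat n * M * ones_mat n) $$ (i, j) = (entry_sum M \<cdot>\<^sub>m ones_mat n) $$ (i, j)"
    using ij by (simp add: ones_mat_def)
qed (use assms in \<open>auto simp: ones_mat_def\<close>)

lemma norm_ones_pos:
  assumes "matrix_norm N" "n \<ge> 1"
  shows "N (ones_mat n) > 0"
proof -
  have "ones_mat n $$ (0, 0) \<noteq> (0\<^sub>m n n :: real mat) $$ (0, 0)"
    using assms(2) by (simp add: ones_mat_def)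
  hence "ones_mat n \<noteq> 0\<^sub>m n n" by metis
  hence "N (ones_mat n) \<noteq> 0"
    using assms(1) ones_mat_carrier[of n] unfolding matrix_norm_def by blast
  moreover have "N (ones_mat n) \<ge> 0" using assms(1) unfolding matrix_norm_def by blast
  ultimately show ?thesis by simp
qed

lemma entry_sum_le_norm:
  assumes N: "matrix_norm N" and n: "n \<ge> 1" and M: "M \<in> carrier_mat n n"
  shows "\<bar>entry_sum M\<bar> \<le> N (ones_mat n) * N M"
proof -
  let ?J = "ones_mat n"
  have mult: "N (A * B) \<le> N A * N B" if "A \<in> carrier_mat n n" "B \<in> carrier_mat n n" for A B
    using N that unfolding matrix_norm_def by blast
  have pos: "N ?J > 0" using norm_ones_pos[OF N n] .
  have "\<bar>entry_sum M\<bar> * N ?J = N (?J * M * ?J)"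
    using N M by (simp add: ones_mult_ones matrix_norm_def)
  also have "\<dots> \<le> N (?J * M) * N ?J"
    using M by (intro mult mult_carrier_mat[where n = n]) auto
  also have "\<dots> \<le> N ?J * N M * N ?J" using M pos by (intro mult_right_mono mult) auto
  finally show ?thesis using pos by (simp add: mult.commute)
qed

lemma norm_ones_ge:
  assumes "matrix_norm N" "n \<ge> 1"
  shows "N (ones_mat n) \<ge> real n"
proof -
  have "entry_sum (ones_mat n) = real n * real n"
    by (simp add: entry_sum_def ones_mat_def)
  hence "real n * real n \<le> N (ones_mat n) * N (ones_mat n)"
    using entry_sum_le_norm[OF assms ones_mat_carrier] by simp
  thus ?thesis
    using norm_ones_pos[OF assms] by (metis less_eq_real_def power2_eq_square power2_le_imp_le)
qed

lemma norm_pow_le: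
  assumes N: "matrix_norm N" and M: "M \<in> carrier_mat n n" and "N M \<le> \<mu>"
  shows "N (M ^\<^sub>m Suc k) \<le> \<mu> ^ Suc k"
proof (induction k)
  case 0
  then show ?case using assms by simp
next
  case (Suc k)
  have nn: "N A \<ge> 0" for A using N unfolding matrix_norm_def by blast
  have "N (M ^\<^sub>m Suc (Suc k)) \<le> N (M ^\<^sub>m Suc k) * N M"
    using N pow_carrier_mat[OF M] M unfolding matrix_norm_def pow_mat.simps(2)[of M "Suc k"] by blast
  also have "\<dots> \<le> \<mu> ^ Suc k * \<mu>"
    using Suc assms(3) nn by (intro mult_mono) (auto intro: order_trans)
  finally show ?case by (simp add: mult_ac)
qed

lemma entry_sum_pow_le:
  assumes N: "matrix_norm N" and n: "n \<ge> 1" and M: "M \<in> carrier_mat n n" and le: "N M \<le> \<mu>"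
  shows "entry_sum (M ^\<^sub>m k) \<le> N (ones_mat n) * \<mu> ^ k"
proof (cases k)
  case 0
  have "entry_sum (1\<^sub>m n) = real n" by (simp add: entry_sum_def)
  thus ?thesis using 0 M norm_ones_ge[OF N n] by simp
next
  case (Suc l)
  have "entry_sum (M ^\<^sub>m k) \<le> N (ones_mat n) * N (M ^\<^sub>m k)"
    using entry_sum_le_norm[OF N n pow_carrier_mat[OF M]] by (meson abs_le_D1)
  also have "\<dots> \<le> N (ones_mat n) * \<mu> ^ k"
    unfolding Suc using norm_pow_le[OF N M le] norm_ones_pos[OF N n] by (intro mult_left_mono) auto
  finally show ?thesis .
qed

lemma entry_sum_eq_sum_col_sum:
  "entry_sum M = (\<Sum>j<dim_col M. col_sum M j)"
  unfolding entry_sum_def col_sum_def by (rule sum.swap)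

lemma col_sum_pow_Suc:
  assumes M: "M \<in> carrier_mat n n" and "j < n"
  shows "col_sum (M ^\<^sub>m Suc k) j = (\<Sum>i<n. col_sum (M ^\<^sub>m k) i * M $$ (i, j))"
proof -
  have c: "M ^\<^sub>m k \<in> carrier_mat n n" using M by simp
  have "col_sum (M ^\<^sub>m Suc k) j = (\<Sum>l<n. \<Sum>i<n. (M ^\<^sub>m k) $$ (l, i) * M $$ (i, j))"
    unfolding pow_mat.simps col_sum_def using M c assms(2)
    by (auto simp: scalar_prod_def atLeast0LessThan intro!: sum.cong)
  also have "\<dots> = (\<Sum>i<n. col_sum (M ^\<^sub>m k) i * M $$ (i, j))"
    using c by (subst sum.swap) (auto simp: col_sum_def sum_distrib_right)
  finally show ?thesis .
qed

lemma col_sum_pow_nonneg: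
  assumes M: "M \<in> carrier_mat n n" and nn: "\<And>i j. i < n \<Longrightarrow> j < n \<Longrightarrow> M $$ (i, j) \<ge> 0" and "j < n"
  shows "col_sum (M ^\<^sub>m k) j \<ge> 0"
  using \<open>j < n\<close>
proof (induction k arbitrary: j)
  case 0
  then show ?case using M by (auto simp: col_sum_def intro!: sum_nonneg)
next
  case (Suc k)
  then show ?case
    unfolding col_sum_pow_Suc[OF M Suc.prems] using nn by (intro sum_nonneg mult_nonneg_nonneg) auto
qed

text \<open>
  The weights are \<open>w = (\<Sum>k<K. 1 (M / \<theta>) ^ k)\<close>, with \<open>1\<close> the all-ones row vector. Multiplying \<open>w\<close> by
  \<open>M / \<theta>\<close> drops the term \<open>k = 0\<close>, which is \<open>1\<close> everywhere, and adds the term \<open>k = K\<close>, which is at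
  most \<open>1\<close> everywhere once \<open>K\<close> is large. A finite sum therefore suffices, and no limit is needed.
\<close>

lemma exists_subinvariant_weights:
  assumes N: "matrix_norm N" and n: "n \<ge> 1" and M: "M \<in> carrier_mat n n"
    and nn: "\<And>i j. i < n \<Longrightarrow> j < n \<Longrightarrow> M $$ (i, j) \<ge> 0"
    and le: "N M \<le> \<mu>" and less: "\<mu> < \<theta>" and "\<theta> \<le> 1"
  shows "\<exists>w :: nat \<Rightarrow> real. (\<forall>i<n. w i \<ge> 1) \<and>
    (\<forall>j<n. (\<Sum>i<n. w i * M $$ (i, j)) \<le> \<theta> * w j) \<and>
    (\<Sum>i<n. w i) \<le> N (ones_mat n) / (\<theta> - \<mu>)"
proof -
  let ?J = "N (ones_mat n)"
  have "0 \<le> N M" using N unfolding matrix_norm_def by blast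
  hence \<mu>0: "0 \<le> \<mu>" using le by simp
  have \<theta>0: "0 < \<theta>" using \<mu>0 less by simp
  define r where "r = \<mu> / \<theta>"
  have r: "0 \<le> r" "r < 1" using \<mu>0 less \<theta>0 by (auto simp: r_def)
  have J: "?J > 0" using norm_ones_pos[OF N n] .
  define a where "a k j = col_sum (M ^\<^sub>m k) j / \<theta> ^ k" for k j
  have a0: "a k j \<ge> 0" if "j < n" for k j
    using col_sum_pow_nonneg[OF M nn that] \<theta>0 by (simp add: a_def)
  have a_sum: "(\<Sum>j<n. a k j) \<le> ?J * r ^ k" for k
  proof -
    have "(\<Sum>j<n. a k j) = entry_sum (M ^\<^sub>m k) / \<theta> ^ k"
      using M by (auto simp: a_def entry_sum_eq_sum_col_sum sum_divide_distrib)
    also have "\<dots> \<le> ?J * \<mu> ^ k / \<theta> ^ k"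
      using entry_sum_pow_le[OF N n M le] \<theta>0 by (intro divide_right_mono) auto
    finally show ?thesis by (simp add: r_def power_divide)
  qed
  have a_start: "a 0 j = 1" if "j < n" for j
    using that M by (simp add: a_def col_sum_def sum.delta if_distrib cong: if_cong)
  have a_step: "(\<Sum>i<n. a k i * M $$ (i, j)) = \<theta> * a (Suc k) j" if "j < n" for k j
    using \<theta>0 unfolding a_def col_sum_pow_Suc[OF M that]
    by (simp add: sum_divide_distrib[symmetric])
  have "(\<lambda>k. ?J * r ^ k) \<longlonglongrightarrow> ?J * 0"
    using r by (intro tendsto_mult_left LIMSEQ_power_zero) auto
  hence "\<forall>\<^sub>F k in sequentially. ?J * r ^ k < 1"
    by (rule order_tendstoD(2)) simp
  then obtain K where K: "?J * r ^ K < 1" by (auto simp: eventually_sequentially)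
  have K0: "0 < K"
    using K norm_ones_ge[OF N n] n by (cases K) auto
  define w where "w j = (\<Sum>k<K. a k j)" for j
  show ?thesis
  proof (intro exI[of _ w] conjI allI impI)
    fix j assume j: "j < n"
    have "a 0 j \<le> w j" unfolding w_def using a0[OF j] K0 by (intro member_le_sum) auto
    thus "w j \<ge> 1" using a_start[OF j] by simp
  next
    fix j assume j: "j < n"
    have "a K j \<le> (\<Sum>i<n. a K i)" using j a0 by (intro member_le_sum) auto
    hence last: "a K j \<le> 1" using a_sum[of K] K by simp
    have "(\<Sum>i<n. w i * M $$ (i, j)) = (\<Sum>k<K. \<Sum>i<n. a k i * M $$ (i, j))"
      unfolding w_def sum_distrib_right by (rule sum.swap)
    also have "\<dots> = \<theta> * (\<Sum>k<K. a (Suc k) j)"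
      using a_step[OF j] by (simp add: sum_distrib_left)
    also have "(\<Sum>k<K. a (Suc k) j) = w j - a 0 j + a K j"
      unfolding w_def using sum.lessThan_Suc_shift[of "\<lambda>k. a k j" K] by simp
    also have "\<dots> \<le> w j" using last a_start[OF j] by simp
    finally show "(\<Sum>i<n. w i * M $$ (i, j)) \<le> \<theta> * w j" using \<theta>0 by simp
  next
    have "(\<Sum>i<n. w i) = (\<Sum>k<K. \<Sum>i<n. a k i)" unfolding w_def by (rule sum.swap)
    also have "\<dots> \<le> (\<Sum>k<K. ?J * r ^ k)" by (intro sum_mono a_sum)
    also have "\<dots> = ?J * (\<Sum>k<K. r ^ k)" by (simp add: sum_distrib_left)
    also have "\<dots> \<le> ?J * (1 / (1 - r))"
      using r J by (intro mult_left_mono) (auto simp: sum_gp_strict divide_simps)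
    also have "1 / (1 - r) = \<theta> / (\<theta> - \<mu>)" using \<theta>0 less by (simp add: r_def field_simps)
    also have "?J * (\<theta> / (\<theta> - \<mu>)) \<le> ?J * (1 / (\<theta> - \<mu>))"
      using J less \<open>\<theta> \<le> 1\<close> by (intro mult_left_mono divide_right_mono) auto
    finally show "(\<Sum>i<n. w i) \<le> ?J / (\<theta> - \<mu>)" by simp
  qed
qed


section \<open>Averaging a function over a transition kernel\<close>

text \<open>The action of a transition matrix on functions (column vectors).\<close>

definition avg :: "'a kernel \<Rightarrow> ('a \<Rightarrow> real) \<Rightarrow> 'a \<Rightarrow> real" where
  "avg K f x = measure_pmf.expectation (K x) f"

text \<open>The rows of \<open>K\<close> indexed by \<open>S\<close> are distributions on \<open>S\<close>.\<close>

definition closed_on :: "'a set \<Rightarrow> 'a kernel \<Rightarrow> bool" where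
  "closed_on S K \<longleftrightarrow> (\<forall>x\<in>S. set_pmf (K x) \<subseteq> S)"

lemma expectation_bind_closed:
  assumes "finite S" "set_pmf p \<subseteq> S" "closed_on S K"
  shows "measure_pmf.expectation (bind_pmf p K) f = measure_pmf.expectation p (avg K f)"
proof -
  have "measure_pmf.expectation (bind_pmf p K) f = (\<Sum>a\<in>S. pmf p a * avg K f a)"
    using assms by (subst pmf_expectation_bind[of S])
      (auto simp: avg_def closed_on_def intro: finite_subset)
  also have "\<dots> = measure_pmf.expectation p (avg K f)"
    using assms by (subst integral_measure_pmf_real[of S]) (auto simp: mult.commute)
  finally show ?thesis .
qed

lemma closed_on_return: "closed_on S return_pmf"
  by (simp add: closed_on_def)

lemma closed_on_kernel_mult:
  "closed_on S K \<Longrightarrow> closed_on S L \<Longrightarrow> closed_on S (kernel_mult K L)"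
  by (fastforce simp: closed_on_def kernel_mult_def)

lemma closed_on_foldr:
  "(\<And>j. j \<in> set js \<Longrightarrow> closed_on S (P j)) \<Longrightarrow>
     closed_on S (foldr kernel_mult (map P js) return_pmf)"
  by (induction js) (auto intro: closed_on_kernel_mult closed_on_return)

lemma avg_kernel_mult:
  assumes "finite S" "closed_on S K" "closed_on S L" "x \<in> S"
  shows "avg (kernel_mult K L) f x = avg K (avg L f) x"
  using expectation_bind_closed[OF assms(1) _ assms(3), of "K x" f] assms(2,4)
  by (auto simp: avg_def kernel_mult_def closed_on_def)

lemma avg_return [simp]: "avg return_pmf f = f"
  by (simp add: avg_def fun_eq_iff)

lemma set_state_after:
  assumes "closed_on S K" "x \<in> S"
  shows "set_pmf (state_after K t x) \<subseteq> S"
  using assms by (induction t) (fastforce simp: state_after_def closed_on_def)+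

lemma expectation_state_after:
  assumes "finite S" "closed_on S K" "x \<in> S"
  shows "measure_pmf.expectation (state_after K t x) f = ((avg K) ^^ t) f x"
proof (induction t arbitrary: f)
  case 0
  then show ?case by (simp add: state_after_def)
next
  case (Suc t)
  have "measure_pmf.expectation (state_after K (Suc t) x) f =
      measure_pmf.expectation (state_after K t x) (avg K f)"
    using expectation_bind_closed[OF assms(1) set_state_after[OF assms(2,3)] assms(2), of t f]
    by (simp add: state_after_def)
  thus ?case using Suc by (simp add: funpow_swap1)
qed

lemma expectation_stationary:
  assumes "finite S" "closed_on S K" "set_pmf p \<subseteq> S" "bind_pmf p K = p"
  shows "measure_pmf.expectation p (((avg K) ^^ t) f) = measure_pmf.expectation p f"
proof (induction t)
  case 0
  then show ?case by simp
next
  case (Suc t)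
  then show ?case
    using expectation_bind_closed[OF assms(1,3,2), of "((avg K) ^^ t) f"] assms(4) by simp
qed

lemma bind_foldr_stationary:
  "(\<And>j. j \<in> set js \<Longrightarrow> bind_pmf p (P j) = p) \<Longrightarrow>
     bind_pmf p (foldr kernel_mult (map P js) return_pmf) = p"
  by (induction js) (auto simp: kernel_mult_def bind_return_pmf' simp flip: bind_assoc_pmf)

section \<open>Oscillations of functions on configurations\<close>

text \<open>
  \<open>d i\<close> bounds the change of \<open>f\<close> under a change of the spin at site \<open>i\<close>. The bounds need not be
  attained.
\<close>

definition oscillation_bound :: "nat \<Rightarrow> nat \<Rightarrow> (nat \<Rightarrow> real) \<Rightarrow> ((nat \<Rightarrow> nat) \<Rightarrow> real) \<Rightarrow> bool" where
  "oscillation_bound n q d f \<longleftrightarrow> (\<forall>i<n. \<forall>(x, y)\<in>differ_at n q i. \<bar>f x - f y\<bar> \<le> d i)"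

lemma oscillation_boundD:
  "oscillation_bound n q d f \<Longrightarrow> i < n \<Longrightarrow> (x, y) \<in> differ_at n q i \<Longrightarrow> \<bar>f x - f y\<bar> \<le> d i"
  by (auto simp: oscillation_bound_def)

lemma finite_configs [simp]: "finite (configs n q)"
  by (simp add: configs_def finite_PiE)

lemma finite_differ_at [simp]: "finite (differ_at n q i)"
  by (rule finite_subset[of _ "configs n q \<times> configs n q"]) (auto simp: differ_at_def)

lemma configs_update: "x \<in> configs n q \<Longrightarrow> j < n \<Longrightarrow> c < q \<Longrightarrow> x(j := c) \<in> configs n q"
  by (auto simp: configs_def PiE_iff extensional_def)

lemma configs_eqI:
  "x \<in> configs n q \<Longrightarrow> y \<in> configs n q \<Longrightarrow> (\<And>i. i < n \<Longrightarrow> x i = y i) \<Longrightarrow> x = y"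
  by (auto simp: configs_def intro: PiE_ext)

lemma configs_lt: "x \<in> configs n q \<Longrightarrow> i < n \<Longrightarrow> x i < q"
  by (auto simp: configs_def PiE_iff)

lemma oscillation_bound_nonneg:
  assumes "oscillation_bound n q d f" "configs n q \<noteq> {}" "i < n"
  shows "d i \<ge> 0"
proof -
  obtain x where "x \<in> configs n q" using assms(2) by auto
  hence "(x, x) \<in> differ_at n q i" by (simp add: differ_at_def)
  from oscillation_boundD[OF assms(1,3) this] show ?thesis by simp
qed

lemma oscillation_bound_total:
  assumes osc: "oscillation_bound n q d f" and x: "x \<in> configs n q" and y: "y \<in> configs n q"
  shows "\<bar>f x - f y\<bar> \<le> (\<Sum>i<n. d i)"
proof -
  have "\<bar>f x - f y\<bar> \<le> (\<Sum>i<k. d i)"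
    if "k \<le> n" "y \<in> configs n q" "\<And>i. k \<le> i \<Longrightarrow> i < n \<Longrightarrow> x i = y i" for k y
    using that
  proof (induction k arbitrary: y)
    case 0
    hence "x = y" using configs_eqI[OF x] by simp
    thus ?case by simp
  next
    case (Suc k)
    let ?z = "y(k := x k)"
    have z: "?z \<in> configs n q" 
      using configs_update[OF Suc.prems(2) _ configs_lt[OF x], of k k] Suc.prems(1) by simp
    have "\<bar>f x - f ?z\<bar> \<le> (\<Sum>i<k. d i)"
    proof (rule Suc.IH)
      show "?z \<in> configs n q" by (rule z)
      show "x i = ?z i" if "k \<le> i" "i < n" for i
        using that Suc.prems(3)[of i] by (cases "i = k") auto
    qed (use Suc.prems in simp)
    moreover have "(?z, y) \<in> differ_at n q k" using z Suc.prems by (auto simp: differ_at_def)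
    hence "\<bar>f ?z - f y\<bar> \<le> d k" using oscillation_boundD[OF osc] Suc.prems(1) by simp
    ultimately show ?case by simp
  qed
  from this[of n y] y show ?thesis by simp
qed

text \<open>
  Two distributions integrate \<open>g\<close> to values that differ by at most their total variation distance
  times the oscillation of \<open>g\<close>. The factor \<open>1/2\<close> in the distance is recovered by subtracting from
  \<open>g\<close> the midpoint of its range.
\<close>

lemma sum_diff_mult_le_tv:
  fixes a b g :: "nat \<Rightarrow> real"
  assumes sums: "(\<Sum>c\<in>A. a c) = (\<Sum>c\<in>A. b c)" and A: "finite A" "A \<noteq> {}"
    and osc: "\<And>c c'. c \<in> A \<Longrightarrow> c' \<in> A \<Longrightarrow> \<bar>g c - g c'\<bar> \<le> D"
  shows "\<bar>\<Sum>c\<in>A. (a c - b c) * g c\<bar> \<le> tv_dist A a b * D"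
proof -
  define m where "m = (Max (g ` A) + Min (g ` A)) / 2"
  have "Max (g ` A) \<in> g ` A" "Min (g ` A) \<in> g ` A"
    by (intro Max_in Min_in finite_imageI; use A in simp)+
  then obtain c c' where "c \<in> A" "c' \<in> A" "Max (g ` A) = g c" "Min (g ` A) = g c'"
    by (auto simp only: image_iff)
  hence D: "Max (g ` A) - Min (g ` A) \<le> D" using osc[of c c'] by simp
  have "(\<Sum>c\<in>A. (a c - b c) * g c) = (\<Sum>c\<in>A. (a c - b c) * (g c - m))"
    using sums by (simp add: right_diff_distrib sum_subtractf flip: sum_distrib_right)
  also have "\<bar>\<dots>\<bar> \<le> (\<Sum>c\<in>A. \<bar>a c - b c\<bar> * (D / 2))"
  proof (intro order_trans[OF sum_abs] sum_mono)
    fix c assume "c \<in> A"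
    hence "g c \<le> Max (g ` A)" "Min (g ` A) \<le> g c" using A by auto
    hence "\<bar>g c - m\<bar> \<le> D / 2" using D unfolding m_def by (auto simp: abs_if field_simps)
    thus "\<bar>(a c - b c) * (g c - m)\<bar> \<le> \<bar>a c - b c\<bar> * (D / 2)"
      unfolding abs_mult by (intro mult_left_mono) auto
  qed
  also have "\<dots> = tv_dist A a b * D"
    by (simp add: tv_dist_def sum_distrib_right sum_divide_distrib)
  finally show ?thesis .
qed

lemma spin_system_closed:
  assumes "spin_system n q \<pi> P" "j < n"
  shows "closed_on (configs n q) (P j)"
  using assms by (auto simp: spin_system_def closed_on_def differ_at_def set_pmf_iff pmf_positive_iff
      dest: pmf_positive)

lemma avg_update:
  assumes S: "spin_system n q \<pi> P" and j: "j < n" and x: "x \<in> configs n q"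
  shows "avg (P j) f x = (\<Sum>c<q. spin_update P j x c * f (x(j := c)))"
proof -
  have inj: "inj_on (\<lambda>c. x(j := c)) {..<q}" by (auto intro!: inj_onI dest: fun_upd_eqD)
  have "a \<in> (\<lambda>c. x(j := c)) ` {..<q}" if "a \<in> set_pmf (P j x)" for a
  proof -
    have a: "(x, a) \<in> differ_at n q j"
      using that S j x by (auto simp: spin_system_def pmf_positive)
    hence "a = x(j := a j)"
      using j x by (intro configs_eqI[of _ n q] configs_update) (auto simp: differ_at_def configs_lt)
    moreover have "a j < q" using a j by (auto simp: differ_at_def intro: configs_lt)
    ultimately show ?thesis by blast
  qed
  hence "avg (P j) f x = (\<Sum>a\<in>(\<lambda>c. x(j := c)) ` {..<q}. f a * pmf (P j x) a)"
    unfolding avg_def by (intro integral_measure_pmf_real) auto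
  thus ?thesis by (simp add: sum.reindex[OF inj] spin_update_def mult.commute)
qed

lemma sum_spin_update:
  assumes "spin_system n q \<pi> P" "j < n" "x \<in> configs n q"
  shows "(\<Sum>c<q. spin_update P j x c) = 1"
  using avg_update[OF assms, of "\<lambda>_. 1"] by (simp add: avg_def)

lemma spin_system_nonempty:
  assumes "spin_system n q \<pi> P"
  shows "configs n q \<noteq> {}"
  using assms set_pmf_not_empty[of \<pi>] by (auto simp: spin_system_def)

lemma tv_le_influence:
  "(x, y) \<in> differ_at n q i \<Longrightarrow>
     tv_dist {..<q} (spin_update P j x) (spin_update P j y) \<le> influence n q P i j"
  unfolding influence_def by (rule Max_ge) auto

lemma tv_dist_nonneg: "tv_dist A f g \<ge> 0"
  by (simp add: tv_dist_def sum_nonneg)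

lemma dependency_matrix_nonneg:
  assumes "spin_system n q \<pi> P" "dependency_matrix n q P R" "i < n" "j < n"
  shows "R $$ (i, j) \<ge> 0"
proof -
  obtain x where "x \<in> configs n q" using spin_system_nonempty[OF assms(1)] by auto
  hence "(x, x) \<in> differ_at n q i" by (simp add: differ_at_def)
  hence "0 \<le> influence n q P i j" using tv_le_influence tv_dist_nonneg by (meson order_trans)
  thus ?thesis using assms by (force simp: dependency_matrix_def)
qed

text \<open>
  For configurations that agree off \<open>i\<close>, the averages are compared by first using the same
  distribution for the new spin at \<open>j\<close>, at a cost of \<open>d i\<close>, or of \<open>0\<close> if \<open>i = j\<close> since the two
  configurations then become equal, and afterwards changing that distribution.
\<close>

lemma oscillation_bound_update:
  assumes S: "spin_system n q \<pi> P" and R: "dependency_matrix n q P R" and j: "j < n"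
    and osc: "oscillation_bound n q d f"
  shows "oscillation_bound n q (\<lambda>i. (if i = j then 0 else d i) + R $$ (i, j) * d j) (avg (P j) f)"
  unfolding oscillation_bound_def
proof safe
  fix i x y assume i: "i < n" and xy: "(x, y) \<in> differ_at n q i"
  hence x: "x \<in> configs n q" and y: "y \<in> configs n q" by (auto simp: differ_at_def)
  have q: "{..<q} \<noteq> {}" using configs_lt[OF x i] by auto
  let ?e = "if i = j then 0 else d i"
  let ?a = "spin_update P j x" and ?b = "spin_update P j y"
  have a0: "?a c \<ge> 0" for c by (simp add: spin_update_def)
  have "avg (P j) f x - avg (P j) f y =
      (\<Sum>c<q. ?a c * (f (x(j := c)) - f (y(j := c)))) + (\<Sum>c<q. (?a c - ?b c) * f (y(j := c)))"
    unfolding avg_update[OF S j x] avg_update[OF S j y]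
    by (simp add: algebra_simps sum_subtractf flip: sum.distrib)
  moreover have "\<bar>\<Sum>c<q. ?a c * (f (x(j := c)) - f (y(j := c)))\<bar> \<le> (\<Sum>c<q. ?a c * ?e)"
  proof (intro order_trans[OF sum_abs] sum_mono)
    fix c assume "c \<in> {..<q}"
    hence c: "x(j := c) \<in> configs n q" "y(j := c) \<in> configs n q"
      using x y j by (auto intro: configs_update)
    have "\<bar>f (x(j := c)) - f (y(j := c))\<bar> \<le> ?e"
    proof (cases "i = j")
      case True
      hence "x(j := c) = y(j := c)"
        using xy c by (intro configs_eqI[of _ n q]) (auto simp: differ_at_def)
      thus ?thesis using True by simp
    next
      case False
      have "(x(j := c), y(j := c)) \<in> differ_at n q i" using xy c by (auto simp: differ_at_def)
      thus ?thesis using oscillation_boundD[OF osc i] False by simp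
    qed
    thus "\<bar>?a c * (f (x(j := c)) - f (y(j := c)))\<bar> \<le> ?a c * ?e"
      unfolding abs_mult abs_of_nonneg[OF a0] by (intro mult_left_mono a0)
  qed
  moreover have "(\<Sum>c<q. ?a c * ?e) = ?e"
    using sum_spin_update[OF S j x] by (simp flip: sum_distrib_right)
  moreover have "\<bar>\<Sum>c<q. (?a c - ?b c) * f (y(j := c))\<bar> \<le> tv_dist {..<q} ?a ?b * d j"
  proof (rule sum_diff_mult_le_tv)
    fix c c' assume "c \<in> {..<q}" "c' \<in> {..<q}"
    hence "(y(j := c), y(j := c')) \<in> differ_at n q j"
      using y j by (auto simp: differ_at_def intro: configs_update)
    thus "\<bar>f (y(j := c)) - f (y(j := c'))\<bar> \<le> d j"
      by (rule oscillation_boundD[OF osc j])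
  qed (use q sum_spin_update[OF S j x] sum_spin_update[OF S j y] in auto)
  moreover have "tv_dist {..<q} ?a ?b * d j \<le> R $$ (i, j) * d j"
    using tv_le_influence[OF xy, of P j] R i j
      oscillation_bound_nonneg[OF osc spin_system_nonempty[OF S] j]
    by (intro mult_right_mono) (force simp: dependency_matrix_def)+
  ultimately show "\<bar>avg (P j) f x - avg (P j) f y\<bar> \<le> ?e + R $$ (i, j) * d j"
    by linarith
qed

section \<open>Contraction of the weighted oscillation\<close>

text \<open>
  The weights are scaled by \<open>\<theta>\<close> one site at a time. An update of site \<open>j\<close> removes \<open>d j\<close> at \<open>j\<close>
  and adds \<open>R $$ (i, j) * d j\<close> at every site \<open>i\<close>. The weight of what is added is at most
  \<open>\<theta> * w j * d j\<close>, which is the contribution of \<open>d j\<close> when site \<open>j\<close> too has a scaled weight.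
\<close>

lemma weighted_oscillation_update:
  fixes w d :: "nat \<Rightarrow> real"
  assumes j: "j < n" and w0: "\<And>i. i < n \<Longrightarrow> w i \<ge> 0" and d0: "d j \<ge> 0"
    and R0: "\<And>i. i < n \<Longrightarrow> R $$ (i, j) \<ge> 0" and "\<theta> \<le> 1"
    and sub: "(\<Sum>i<n. w i * R $$ (i, j)) \<le> \<theta> * w j"
  shows "(\<Sum>i<n. (if i < j then \<theta> * w i else w i) * ((if i = j then 0 else d i) + R $$ (i, j) * d j))
    \<le> (\<Sum>i<n. (if i < Suc j then \<theta> * w i else w i) * d i)"
proof -
  let ?W = "\<lambda>k i. if i < k then \<theta> * w i else w i"
  have W: "?W j i \<le> w i" if "i < n" for i
    using w0[OF that] \<open>\<theta> \<le> 1\<close> mult_right_mono[of \<theta> 1 "w i"] by auto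
  have "(\<Sum>i<n. ?W j i * ((if i = j then 0 else d i) + R $$ (i, j) * d j)) =
      (\<Sum>i<n. if i = j then 0 else ?W (Suc j) i * d i) + (\<Sum>i<n. ?W j i * R $$ (i, j)) * d j"
    unfolding sum_distrib_right sum.distrib[symmetric]
    by (intro sum.cong) (auto simp: algebra_simps)
  also have "(\<Sum>i<n. ?W j i * R $$ (i, j)) \<le> (\<Sum>i<n. w i * R $$ (i, j))"
    using W R0 by (intro sum_mono mult_right_mono) auto
  also have "\<dots> \<le> \<theta> * w j" by (rule sub)
  also have "(\<Sum>i<n. if i = j then 0 else ?W (Suc j) i * d i) + \<theta> * w j * d j =
      (\<Sum>i<n. ?W (Suc j) i * d i)"
    using j by (simp add: sum.remove[of "{..<n}" j])
  finally show ?thesis using d0 by (simp add: mult_right_mono)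
qed

lemma oscillation_bound_scan:
  fixes w :: "nat \<Rightarrow> real"
  assumes S: "spin_system n q \<pi> P" and R: "dependency_matrix n q P R"
    and w0: "\<And>i. i < n \<Longrightarrow> w i \<ge> 0" and "\<theta> \<le> 1"
    and sub: "\<And>j. j < n \<Longrightarrow> (\<Sum>i<n. w i * R $$ (i, j)) \<le> \<theta> * w j"
    and osc: "oscillation_bound n q d f"
  shows "\<exists>d'. oscillation_bound n q d' (avg (scan n P) f) \<and>
    (\<Sum>i<n. w i * d' i) \<le> \<theta> * (\<Sum>i<n. w i * d i)"
proof -
  let ?K = "\<lambda>j. foldr kernel_mult (map P [j..<n]) return_pmf"
  let ?W = "\<lambda>k i. if i < k then \<theta> * w i else w i"
  have "\<exists>d'. oscillation_bound n q d' (avg (?K j) f) \<and>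
      (\<Sum>i<n. ?W j i * d' i) \<le> \<theta> * (\<Sum>i<n. w i * d i)" if "j \<le> n" for j
    using that
    \<comment> \<open>Averaging applies the last update first, so the induction goes down from \<open>n\<close>, where all
        weights are scaled, to \<open>0\<close>, where none is.\<close>
  proof (induction rule: inc_induct)
    case base
    then show ?case using osc by (auto simp: sum_distrib_left mult.assoc intro!: exI[of _ d])
  next
    case (step j)
    then obtain d' where d': "oscillation_bound n q d' (avg (?K (Suc j)) f)"
      and le: "(\<Sum>i<n. ?W (Suc j) i * d' i) \<le> \<theta> * (\<Sum>i<n. w i * d i)" by blast
    let ?d = "\<lambda>i. (if i = j then 0 else d' i) + R $$ (i, j) * d' j"
    have j: "j < n" using step by simp
    have closed: "closed_on (configs n q) (?K (Suc j))"
      using spin_system_closed[OF S] by (intro closed_on_foldr) auto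
    have "avg (?K j) f x = avg (P j) (avg (?K (Suc j)) f) x" if "x \<in> configs n q" for x
      using avg_kernel_mult[OF finite_configs spin_system_closed[OF S j] closed that] j
      by (simp add: upt_conv_Cons)
    hence "oscillation_bound n q ?d (avg (?K j) f)"
      using oscillation_bound_update[OF S R j d']
      by (auto simp: oscillation_bound_def differ_at_def)
    moreover have "(\<Sum>i<n. ?W j i * ?d i) \<le> \<theta> * (\<Sum>i<n. w i * d i)"
      using oscillation_bound_nonneg[OF d' spin_system_nonempty[OF S] j]
        dependency_matrix_nonneg[OF S R _ j]
      by (intro order_trans[OF weighted_oscillation_update le]) (use assms j in auto)
    ultimately show ?case by blast
  qed
  from this[of 0] show ?thesis by (simp add: scan_def)
qed

lemma oscillation_bound_scans:
  fixes w :: "nat \<Rightarrow> real"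
  assumes S: "spin_system n q \<pi> P" and R: "dependency_matrix n q P R"
    and w0: "\<And>i. i < n \<Longrightarrow> w i \<ge> 0" and \<theta>: "0 \<le> \<theta>" "\<theta> \<le> 1"
    and sub: "\<And>j. j < n \<Longrightarrow> (\<Sum>i<n. w i * R $$ (i, j)) \<le> \<theta> * w j"
    and osc: "oscillation_bound n q d f"
  shows "\<exists>d'. oscillation_bound n q d' ((avg (scan n P) ^^ t) f) \<and>
    (\<Sum>i<n. w i * d' i) \<le> \<theta> ^ t * (\<Sum>i<n. w i * d i)"
proof (induction t)
  case 0
  then show ?case using osc by auto
next
  case (Suc t)
  then obtain d' where d': "oscillation_bound n q d' ((avg (scan n P) ^^ t) f)"
    and le: "(\<Sum>i<n. w i * d' i) \<le> \<theta> ^ t * (\<Sum>i<n. w i * d i)" by blast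
  obtain d'' where d'': "oscillation_bound n q d'' (avg (scan n P) ((avg (scan n P) ^^ t) f))"
    and le': "(\<Sum>i<n. w i * d'' i) \<le> \<theta> * (\<Sum>i<n. w i * d' i)"
    using oscillation_bound_scan[OF S R w0 \<theta>(2) sub d'] by blast
  note le'
  also have "\<theta> * (\<Sum>i<n. w i * d' i) \<le> \<theta> * (\<theta> ^ t * (\<Sum>i<n. w i * d i))"
    using le \<theta> by (intro mult_left_mono) auto
  finally show ?case using d'' by (auto simp: mult.assoc)
qed

text \<open>
  The test function that attains the total variation distance takes the values \<open>1/2\<close> and \<open>- 1/2\<close>,
  so its oscillation is at most \<open>1\<close>.
\<close>

lemma tv_dist_eq_expectation_diff:
  assumes "finite S" "set_pmf p \<subseteq> S" "set_pmf p' \<subseteq> S"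
  defines "f \<equiv> \<lambda>z. if pmf p z \<ge> pmf p' z then 1 / 2 else - 1 / 2 :: real"
  shows "tv_dist S (pmf p) (pmf p') = measure_pmf.expectation p f - measure_pmf.expectation p' f"
proof -
  have "measure_pmf.expectation p f - measure_pmf.expectation p' f =
      (\<Sum>z\<in>S. f z * pmf p z) - (\<Sum>z\<in>S. f z * pmf p' z)"
    using assms(1-3) by (subst (1 2) integral_measure_pmf_real[of S]) auto
  also have "\<dots> = tv_dist S (pmf p) (pmf p')"
    unfolding tv_dist_def sum_divide_distrib sum_subtractf[symmetric]
    by (intro sum.cong) (auto simp: f_def)
  finally show ?thesis by simp
qed

lemma tv_dist_scan_le:
  fixes w :: "nat \<Rightarrow> real"
  assumes S: "spin_system n q \<pi> P" and R: "dependency_matrix n q P R"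
    and w1: "\<And>i. i < n \<Longrightarrow> w i \<ge> 1" and \<theta>: "0 \<le> \<theta>" "\<theta> \<le> 1"
    and sub: "\<And>j. j < n \<Longrightarrow> (\<Sum>i<n. w i * R $$ (i, j)) \<le> \<theta> * w j"
    and x: "x \<in> configs n q"
  shows "tv_dist (configs n q) (pmf (state_after (scan n P) t x)) (pmf \<pi>) \<le> \<theta> ^ t * (\<Sum>i<n. w i)"
proof -
  let ?S = "configs n q" and ?K = "scan n P"
  have K: "closed_on ?S ?K"
    unfolding scan_def using spin_system_closed[OF S] by (intro closed_on_foldr) auto
  have \<pi>: "set_pmf \<pi> \<subseteq> ?S" "bind_pmf \<pi> ?K = \<pi>"
    using S unfolding scan_def by (auto simp: spin_system_def intro!: bind_foldr_stationary)
  let ?p = "state_after ?K t x"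
  define f :: "(nat \<Rightarrow> nat) \<Rightarrow> real"
    where "f = (\<lambda>z. if pmf ?p z \<ge> pmf \<pi> z then 1 / 2 else - 1 / 2)"
  define F where "F = (avg ?K ^^ t) f"
  have "oscillation_bound n q (\<lambda>_. 1) f" by (auto simp: oscillation_bound_def f_def)
  then obtain d where d: "oscillation_bound n q d F"
    and le: "(\<Sum>i<n. w i * d i) \<le> \<theta> ^ t * (\<Sum>i<n. w i)"
    using oscillation_bound_scans[OF S R _ \<theta> sub, of "\<lambda>_. 1" f t] w1 unfolding F_def
    by (fastforce intro: order_trans[of 0 1])
  have d_sum: "(\<Sum>i<n. d i) \<le> (\<Sum>i<n. w i * d i)"
    using w1 oscillation_bound_nonneg[OF d spin_system_nonempty[OF S]]
    by (intro sum_mono) (use mult_right_mono[of 1] in fastforce)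
  have "tv_dist ?S (pmf ?p) (pmf \<pi>) =
      measure_pmf.expectation ?p f - measure_pmf.expectation \<pi> f"
    unfolding f_def using set_state_after[OF K x] \<pi>(1)
    by (intro tv_dist_eq_expectation_diff) auto
  also have "\<dots> = F x - measure_pmf.expectation \<pi> F"
    unfolding F_def expectation_state_after[OF finite_configs K x]
      expectation_stationary[OF finite_configs K \<pi>] ..
  also have "\<dots> = (\<Sum>z\<in>?S. (F x - F z) * pmf \<pi> z)"
    using \<pi>(1) sum_pmf_eq_1[of ?S \<pi>]
    by (subst integral_measure_pmf_real[of ?S])
       (auto simp: left_diff_distrib sum_subtractf simp flip: sum_distrib_left)
  also have "\<dots> \<le> (\<Sum>z\<in>?S. (\<Sum>i<n. d i) * pmf \<pi> z)"
    using oscillation_bound_total[OF d x] by (intro sum_mono mult_right_mono) (auto simp: abs_le_iff)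
  also have "\<dots> = (\<Sum>i<n. d i)"
    using \<pi>(1) sum_pmf_eq_1[of ?S \<pi>] by (simp flip: sum_distrib_left)
  finally show ?thesis using d_sum le by linarith
qed

section \<open>The mixing time\<close>

lemma scan_mixing_time_le:
  assumes "\<And>x. x \<in> configs n q \<Longrightarrow>
    tv_dist (configs n q) (pmf (state_after (scan n P) t x)) (pmf \<pi>) \<le> \<epsilon>"
  shows "scan_mixing_time n q \<pi> P \<epsilon> \<le> enat t"
  unfolding scan_mixing_time_def using assms by (intro INF_lower) auto

text \<open>The parameter \<open>\<kappa>\<close> places the contraction rate \<open>\<theta> = \<mu> + (1 - \<mu>) * \<kappa>\<close> between \<open>\<mu>\<close> and \<open>1\<close>.\<close>

lemma scan_mixing_time_bound:
  assumes S: "spin_system n q \<pi> P" and R: "dependency_matrix n q P R" and N: "matrix_norm N"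
    and n: "n \<ge> 1" and le: "N R \<le> \<mu>" and \<mu>: "\<mu> < 1" and \<kappa>: "0 < \<kappa>" "\<kappa> < 1"
    and \<epsilon>: "0 < \<epsilon>" "\<epsilon> < 1"
  shows "scan_mixing_time n q \<pi> P \<epsilon> \<le>
    enat (nat \<lceil>ln (N (ones_mat n) / ((1 - \<mu>) * \<kappa> * \<epsilon>)) / ((1 - \<mu>) * (1 - \<kappa>))\<rceil>)"
    (is "_ \<le> enat ?t")
proof (rule scan_mixing_time_le)
  fix x assume x: "x \<in> configs n q"
  let ?J = "N (ones_mat n)"
  define \<theta> where "\<theta> = \<mu> + (1 - \<mu>) * \<kappa>"
  have "0 \<le> N R" using N unfolding matrix_norm_def by blast
  hence \<mu>0: "0 \<le> \<mu>" using le by simp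
  have \<theta>: "\<mu> < \<theta>" "\<theta> - \<mu> = (1 - \<mu>) * \<kappa>" "1 - \<theta> = (1 - \<mu>) * (1 - \<kappa>)"
    using \<mu> \<kappa> by (auto simp: \<theta>_def algebra_simps)
  have "0 < 1 - \<theta>" unfolding \<theta>(3) using \<mu> \<kappa> by simp
  hence \<theta>1: "0 \<le> \<theta>" "\<theta> \<le> 1" using \<mu>0 \<theta>(1) by simp_all
  have J: "?J > 0" using norm_ones_pos[OF N n] .
  define c where "c = ?J / ((1 - \<mu>) * \<kappa>)"
  have c: "c > 0" using J \<mu> \<kappa> by (simp add: c_def)
  have Rc: "R \<in> carrier_mat n n" using R by (simp add: dependency_matrix_def)
  obtain w where w: "\<And>i. i < n \<Longrightarrow> w i \<ge> (1::real)"
    "\<And>j. j < n \<Longrightarrow> (\<Sum>i<n. w i * R $$ (i, j)) \<le> \<theta> * w j" "(\<Sum>i<n. w i) \<le> c"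
    using exists_subinvariant_weights[OF N n Rc dependency_matrix_nonneg[OF S R] le \<theta>(1) \<theta>1(2)]
    unfolding c_def \<theta>(2) by auto
  have "ln (c / \<epsilon>) / (1 - \<theta>) \<le> real ?t"
    unfolding \<theta>(3) c_def by (simp add: real_nat_ceiling_ge)
  hence t: "ln (c / \<epsilon>) \<le> (1 - \<theta>) * real ?t"
    using \<open>0 < 1 - \<theta>\<close> by (simp add: field_simps)
  have "\<theta> \<le> exp (\<theta> - 1)" using exp_ge_add_one_self[of "\<theta> - 1"] by simp
  hence "\<theta> ^ ?t \<le> exp (\<theta> - 1) ^ ?t" using \<theta>1 by (intro power_mono)
  also have "\<dots> = exp (- ((1 - \<theta>) * real ?t))" by (simp add: algebra_simps flip: exp_of_nat_mult)
  also have "\<dots> \<le> exp (- ln (c / \<epsilon>))" using t by simp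
  also have "\<dots> = \<epsilon> / c" using c \<epsilon> by (simp add: exp_minus)
  finally have "\<theta> ^ ?t \<le> \<epsilon> / c" .
  hence "\<theta> ^ ?t * (\<Sum>i<n. w i) \<le> \<epsilon> / c * c"
    using w \<theta>1 c \<epsilon> by (intro mult_mono sum_nonneg) (auto intro: order_trans[of 0 1])
  hence "\<theta> ^ ?t * (\<Sum>i<n. w i) \<le> \<epsilon>" using c by simp
  thus "tv_dist (configs n q) (pmf (state_after (scan n P) ?t x)) (pmf \<pi>) \<le> \<epsilon>"
    using tv_dist_scan_le[OF S R w(1) \<theta>1 w(2) x, of ?t] by simp
qed

text \<open>
  The bound on the ratio depends on \<open>n\<close> only, which allows \<open>\<mu>\<close> and \<open>J\<close> to vary with \<open>n\<close>. The
  condition \<open>n \<ge> 3\<close> ensures \<open>ln n > 1\<close>, hence \<open>\<kappa> < 1\<close>.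
\<close>

lemma mixing_ratio_le:
  fixes \<mu> J \<epsilon> :: real
  assumes n: "n \<ge> 3" and \<mu>: "0 \<le> \<mu>" "\<mu> < 1" and \<epsilon>: "0 < \<epsilon>" "\<epsilon> < 1" and J: "J \<ge> real n"
  defines "D \<equiv> inverse (1 - \<mu>) * ln (inverse (1 - \<mu>) * J / \<epsilon>)"
    and "\<kappa> \<equiv> 1 / ln (real n)"
  shows "D > 0" and "0 < \<kappa>" and "\<kappa> < 1"
    and "real (nat \<lceil>ln (J / ((1 - \<mu>) * \<kappa> * \<epsilon>)) / ((1 - \<mu>) * (1 - \<kappa>))\<rceil>) / D \<le>
      (1 + ln (ln (real n)) / ln (real n)) / (1 - 1 / ln (real n)) + 1 / ln (real n)"
proof -
  define l where "l = ln (real n)"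
  define A where "A = inverse (1 - \<mu>)"
  define L where "L = ln (A * J / \<epsilon>)"
  have "exp 1 < real n" using e_less_272 n by linarith
  hence l: "l > 1" using n unfolding l_def by (metis exp_less_cancel_iff exp_ln exp_gt_zero order.strict_trans)
  have A: "A \<ge> 1" unfolding A_def using \<mu> by (simp add: one_le_inverse)
  have J0: "J > 0" using J n by linarith
  have "real n \<le> A * J / \<epsilon>"
  proof -
    have "real n * \<epsilon> \<le> J * 1" using J \<epsilon> by (intro mult_mono) auto
    also have "\<dots> \<le> J * A" using A J0 by (intro mult_left_mono) auto
    finally show ?thesis using \<epsilon> by (simp add: field_simps)
  qed
  hence L: "L \<ge> l" unfolding L_def l_def using n by (intro ln_mono) auto
  have D: "D = A * L" by (simp add: D_def A_def L_def)
  have \<kappa>: "\<kappa> = 1 / l" by (simp add: \<kappa>_def l_def)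
  show D0: "D > 0" unfolding D using A L l by simp
  show \<kappa>0: "0 < \<kappa>" and \<kappa>1: "\<kappa> < 1" unfolding \<kappa> using l by auto
  have ll: "ln l \<ge> 0" using l by simp
  have "J / ((1 - \<mu>) * \<kappa> * \<epsilon>) = (A * J / \<epsilon>) * l"
    unfolding A_def \<kappa> by (simp add: field_simps)
  hence "ln (J / ((1 - \<mu>) * \<kappa> * \<epsilon>)) = L + ln l"
    unfolding L_def using A J0 \<epsilon> l ln_mult_pos[of "A * J / \<epsilon>" l] by simp
  hence eq: "ln (J / ((1 - \<mu>) * \<kappa> * \<epsilon>)) / ((1 - \<mu>) * (1 - \<kappa>)) = A * (L + ln l) / (1 - \<kappa>)"
    unfolding A_def by (simp add: field_simps)
  define T where "T = A * (L + ln l) / (1 - \<kappa>)"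
  have T0: "T \<ge> 0" unfolding T_def using A L l ll \<kappa>1 by auto
  have "real (nat \<lceil>T\<rceil>) \<le> T + 1" using T0 by linarith
  hence "real (nat \<lceil>T\<rceil>) / D \<le> (T + 1) / D" using D0 by (intro divide_right_mono) auto
  also have "\<dots> = (1 + ln l / L) / (1 - \<kappa>) + 1 / (A * L)"
    unfolding T_def D using A L l \<kappa>1 by (simp add: field_simps)
  also have "\<dots> \<le> (1 + ln l / l) / (1 - \<kappa>) + 1 / l"
  proof (intro add_mono divide_right_mono divide_left_mono order_refl)
    have "1 * l \<le> A * L" using A L l by (intro mult_mono) auto
    thus "l \<le> A * L" by simp
  qed (use A L l ll \<kappa>1 in auto)
  finally show "real (nat \<lceil>ln (J / ((1 - \<mu>) * \<kappa> * \<epsilon>)) / ((1 - \<mu>) * (1 - \<kappa>))\<rceil>) / D \<le>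
      (1 + ln (ln (real n)) / ln (real n)) / (1 - 1 / ln (real n)) + 1 / ln (real n)"
    unfolding eq T_def[symmetric] l_def[symmetric] by (simp add: \<kappa>)
qed

theorem lemma2:
  fixes q :: "nat \<Rightarrow> nat"
    and \<pi> :: "nat \<Rightarrow> (nat \<Rightarrow> nat) pmf"
    and P :: "nat \<Rightarrow> nat \<Rightarrow> (nat \<Rightarrow> nat) kernel"
    and R :: "nat \<Rightarrow> real mat"
    and N :: "nat \<Rightarrow> real mat \<Rightarrow> real"
    and \<mu> :: "nat \<Rightarrow> real"
    and \<epsilon> :: real
  assumes "\<And>n. n \<ge> 1 \<Longrightarrow> spin_system n (q n) (\<pi> n) (P n)"
    and "\<And>n. n \<ge> 1 \<Longrightarrow> dependency_matrix n (q n) (P n) (R n)"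
    and "\<And>n. n \<ge> 1 \<Longrightarrow> matrix_norm (N n)"
    and "\<And>n. n \<ge> 1 \<Longrightarrow> N n (R n) \<le> \<mu> n"
    and "\<And>n. n \<ge> 1 \<Longrightarrow> \<mu> n < 1"
    and "0 < \<epsilon>" and "\<epsilon> < 1"
  shows "limsup (\<lambda>n. ereal_of_enat (scan_mixing_time n (q n) (\<pi> n) (P n) \<epsilon>) /
           ereal (inverse (1 - \<mu> n) * ln (inverse (1 - \<mu> n) * N n (ones_mat n) / \<epsilon>))) \<le> 1"
proof -
  let ?J = "\<lambda>n. N n (ones_mat n)"
  let ?D = "\<lambda>n. inverse (1 - \<mu> n) * ln (inverse (1 - \<mu> n) * ?J n / \<epsilon>)"
  let ?\<tau> = "\<lambda>n. scan_mixing_time n (q n) (\<pi> n) (P n) \<epsilon>"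
  define g :: "nat \<Rightarrow> real" where
    "g n = (1 + ln (ln (real n)) / ln (real n)) / (1 - 1 / ln (real n)) + 1 / ln (real n)" for n
  have "ereal_of_enat (?\<tau> n) / ereal (?D n) \<le> ereal (g n)" if n3: "n \<ge> 3" for n
  proof -
    have n: "n \<ge> 1" using n3 by simp
    have "0 \<le> N n (R n)" using assms(3)[OF n] unfolding matrix_norm_def by blast
    hence \<mu>0: "0 \<le> \<mu> n" using assms(4)[OF n] by simp
    note r = mixing_ratio_le[OF n3 \<mu>0 assms(5)[OF n] assms(6,7) norm_ones_ge[OF assms(3)[OF n] n]]
    define t where "t = nat \<lceil>ln (?J n / ((1 - \<mu> n) * (1 / ln (real n)) * \<epsilon>)) /
      ((1 - \<mu> n) * (1 - 1 / ln (real n)))\<rceil>"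
    have "?\<tau> n \<le> enat t"
      unfolding t_def using scan_mixing_time_bound[OF assms(1-3)[OF n] n assms(4,5)[OF n] r(2,3) assms(6,7)] .
    hence "ereal_of_enat (?\<tau> n) / ereal (?D n) \<le> ereal_of_enat (enat t) / ereal (?D n)"
      using r(1) by (intro ereal_divide_right_mono) (simp_all del: ereal_of_enat_simps add: ereal_of_enat_le_iff)
    also have "\<dots> = ereal (real t / ?D n)" using r(1) by (auto simp: divide_ereal_def divide_inverse)
    also have "\<dots> \<le> ereal (g n)" using r(4) unfolding t_def g_def by simp
    finally show ?thesis .
  qed
  hence "limsup (\<lambda>n. ereal_of_enat (?\<tau> n) / ereal (?D n)) \<le> limsup (\<lambda>n. ereal (g n))"
    by (intro Limsup_mono) (auto simp: eventually_sequentially)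
  also have "g \<longlonglongrightarrow> 1" unfolding g_def by real_asymp
  hence "limsup (\<lambda>n. ereal (g n)) = 1"
    by (intro lim_imp_Limsup) (auto simp: one_ereal_def)
  finally show ?thesis .
qed

end
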